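(* Let $G$ be a finite abelian group with $|G|\ge 3$. (1) For every $\alpha\in\mathbb N$, $$\lim_{n\to\infty}\frac{\bigl|\{B\in\mathcal B_\rho(G): |B|\le n-\alpha\}\bigr|}{\bigl|\{B\in\mathcal B_\rho(G): |B|\le n\}\bigr|}=1.$$ (2) Suppose that there are $g_1,g_2\in G$ and minimal zero-sum sequences $U_1,U_2$ over $G$ such that $|U_1|=|U_2|=\mathsf D(G)$, $g_1g_2\mid U_1$ and $(g_1+g_2)\mid U_2$ (divisibility in $\mathcal F(G)$). Then $$\lim_{n\to\infty}\frac{\bigl|\{B\in\mathcal B_\rho(G): |B|\le n,\ \mathsf L(B)\text{ is an interval}\}\bigr|}{\bigl|\{B\in\mathcal B_\rho(G): |B|\le n\}\bigr|}=1.$$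
   Context: For a finite abelian group $G$ (written additively), $\mathcal F(G)$ is the free abelian monoid with basis $G$ (written multiplicatively), whose elements are called sequences over $G$. For $S=g_1\cdots g_\ell\in\mathcal F(G)$, $|S|=\ell$ is its length and $\sigma(S)=g_1+\dots+g_\ell$ its sum. $\mathcal B(G)=\{S\in\mathcal F(G):\sigma(S)=0\}$ is the monoid of zero-sum sequences over $G$; $\mathcal A(G)$ is its set of atoms (irreducible elements), called minimal zero-sum sequences over $G$. The Davenport constant is $\mathsf D(G)=\max\{|U|:U\in\mathcal A(G)\}$. For a non-identity $A\in\mathcal B(G)$, the length set $\mathsf L(A)$ is the set of all $k\in\mathbb N$ such that $A$ is a product of $k$ atoms of $\mathcal B(G)$; the identity has length set $\{0\}$. For a finite nonempty $L\subset\mathbb N$, $\rho(L)=\max L/\min L$; $\rho(\mathcal B(G))=\sup\rho(\mathsf L(A))$ over all non-identity $A\in\mathcal B(G)$ (it is known that for $|G|\ge 3$ this equals $\mathsf D(G)/2$). $\mathcal B_\rho(G)$ is the set consisting of the identity element of $\mathcal B(G)$ and all $A\in\mathcal B(G)$ with $\rho(\mathsf L(A))=\rho(\mathcal B(G))$. An interval is a finite nonempty set of consecutive integers. *)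

theory Defs
  imports Complex_Main "HOL-Library.Multiset" "HOL-Library.Cardinality"
begin

text \<open>
  The finite abelian group \<open>G\<close> is a type \<open>'a\<close> of class \<open>{finite, ab_group_add}\<close>, and the free
  abelian monoid over \<open>G\<close> is \<^typ>\<open>'a multiset\<close>, written additively: the product of sequences is
  \<open>+\<close>, the identity is \<open>{#}\<close>, the length is \<^const>\<open>size\<close>, the sum is \<^const>\<open>sum_mset\<close>, and
  divisibility is \<^const>\<open>subseteq_mset\<close>.
\<close>

definition zero_sum_seqs :: "'a::ab_group_add multiset set" where
  "zero_sum_seqs = {S. sum_mset S = 0}"

text \<open>The only unit of the monoid of zero-sum sequences is \<open>{#}\<close>.\<close>

definition min_zero_sum_seqs :: "'a::ab_group_add multiset set" where
  "min_zero_sum_seqs = {U \<in> zero_sum_seqs. U \<noteq> {#} \<and>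
     (\<forall>S \<in> zero_sum_seqs. \<forall>T \<in> zero_sum_seqs. U = S + T \<longrightarrow> S = {#} \<or> T = {#})}"

definition davenport :: "'a::{finite, ab_group_add} itself \<Rightarrow> nat" where
  "davenport _ = Max {size U | U :: 'a multiset. U \<in> min_zero_sum_seqs}"

text \<open>
  A factorization is a multiset of atoms; the empty factorization gives the identity the
  length set \<open>{0}\<close>.
\<close>

definition length_set :: "'a::ab_group_add multiset \<Rightarrow> nat set" where
  "length_set A = {size F | F. set_mset F \<subseteq> min_zero_sum_seqs \<and> sum_mset F = A}"

definition set_elasticity :: "nat set \<Rightarrow> real" where
  "set_elasticity L = real (Max L) / real (Min L)"

text \<open>
  The supremum is taken over a nonempty bounded set of reals (see \<open>bdd_above_elasticities\<close>), so
  the conditionally complete \<^const>\<open>Sup\<close> on \<^typ>\<open>real\<close> is the true supremum.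
\<close>

definition elasticity :: "'a::{finite, ab_group_add} itself \<Rightarrow> real" where
  "elasticity _ = (SUP A \<in> zero_sum_seqs - {{#} :: 'a multiset}. set_elasticity (length_set A))"

definition max_elastic_seqs :: "'a::{finite, ab_group_add} multiset set" where
  "max_elastic_seqs = insert {#}
     {A \<in> zero_sum_seqs. A \<noteq> {#} \<and> set_elasticity (length_set A) = elasticity TYPE('a)}"

definition is_nat_interval :: "nat set \<Rightarrow> bool" where
  "is_nat_interval L \<longleftrightarrow> (\<exists>a b. a \<le> b \<and> L = {a..b})"


text \<open>All maxima, minima, suprema and cardinalities involved are of finite or bounded sets.\<close>

lemma finite_size_le: "finite {A :: 'a::finite multiset. size A \<le> n}"
proof -
  have "{A :: 'a multiset. size A \<le> n} \<subseteq> mset ` {xs. set xs \<subseteq> UNIV \<and> length xs \<le> n}"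
  proof
    fix A :: "'a multiset" assume "A \<in> {A. size A \<le> n}"
    moreover obtain xs where "A = mset xs" using ex_mset[of A] by auto
    ultimately show "A \<in> mset ` {xs. set xs \<subseteq> UNIV \<and> length xs \<le> n}" by auto
  qed
  then show ?thesis
    by (rule finite_surj[OF finite_lists_length_le[OF finite]])
qed

lemma size_min_zero_sum_le:
  fixes U :: "'a::{finite, ab_group_add} multiset"
  assumes U: "U \<in> min_zero_sum_seqs"
  shows "size U \<le> CARD('a)"
proof (rule ccontr)
  assume "\<not> size U \<le> CARD('a)"
  then have big: "size U > CARD('a)" by simp
  obtain xs where xs: "U = mset xs" using ex_mset[of U] by auto
  define f where "f i = sum_list (take i xs)" for i
  have "card (f ` {..<length xs}) \<le> CARD('a)" by (simp add: card_mono)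
  moreover have "CARD('a) < card {..<length xs}" using big xs by simp
  ultimately have "\<not> inj_on f {..<length xs}"
    by (intro pigeonhole) linarith
  then obtain k l where "k < length xs" "l < length xs" "f k = f l" "k \<noteq> l"
    unfolding inj_on_def by blast
  then obtain i j where ij: "i < j" "j < length xs" "f i = f j"
    by (cases k l rule: linorder_cases) metis+
  define S where "S = mset (drop i (take j xs))"
  define T where "T = mset (take i xs) + mset (drop j xs)"
  have tj: "take j xs = take i xs @ drop i (take j xs)"
    using append_take_drop_id[of i "take j xs"] ij(1) by (simp add: min_def)
  have "mset xs = mset (take j xs) + mset (drop j xs)"
    by (simp flip: mset_append)
  also have "mset (take j xs) = mset (take i xs) + S"
    unfolding S_def by (subst tj) (rule mset_append)
  finally have UST: "U = S + T" unfolding T_def xs by simp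
  have "f j = f i + sum_list (drop i (take j xs))"
    unfolding f_def by (subst tj) (rule sum_list_append)
  then have S0: "sum_mset S = 0" using ij(3) unfolding S_def by (simp add: sum_mset_sum_list)
  moreover have "sum_mset U = 0" using U unfolding min_zero_sum_seqs_def zero_sum_seqs_def by simp
  ultimately have T0: "sum_mset T = 0" using UST by simp
  have "S \<noteq> {#}" "T \<noteq> {#}" using ij unfolding S_def T_def by auto
  moreover have "S \<in> zero_sum_seqs" "T \<in> zero_sum_seqs"
    using S0 T0 unfolding zero_sum_seqs_def by simp_all
  ultimately show False using U UST unfolding min_zero_sum_seqs_def by blast
qed

lemma finite_min_zero_sum_seqs: "finite (min_zero_sum_seqs :: 'a::{finite, ab_group_add} multiset set)"
  by (rule finite_subset[OF _ finite_size_le[of "CARD('a)"]]) (auto dest: size_min_zero_sum_le)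

lemma length_set_nonempty:
  fixes A :: "'a::ab_group_add multiset"
  assumes "A \<in> zero_sum_seqs"
  shows "length_set A \<noteq> {}"
proof -
  have "\<exists>F. set_mset F \<subseteq> min_zero_sum_seqs \<and> sum_mset F = A"
    using assms
  proof (induction "size A" arbitrary: A rule: less_induct)
    case less
    consider "A = {#}" | "A \<in> min_zero_sum_seqs"
      | S T where "S \<in> zero_sum_seqs" "T \<in> zero_sum_seqs" "A = S + T" "S \<noteq> {#}" "T \<noteq> {#}"
      using less.prems unfolding min_zero_sum_seqs_def by blast
    then show ?case
    proof cases
      case 1
      then show ?thesis by (intro exI[of _ "{#}"]) simp
    next
      case 2
      then show ?thesis by (intro exI[of _ "{#A#}"]) simp
    next
      case 3
      then have "size S < size A" "size T < size A" by (simp_all add: nonempty_has_size)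
      then obtain F F' where "set_mset F \<subseteq> min_zero_sum_seqs" "sum_mset F = S"
        "set_mset F' \<subseteq> min_zero_sum_seqs" "sum_mset F' = T"
        using less.hyps 3 by meson
      then show ?thesis using 3 by (intro exI[of _ "F + F'"]) simp
    qed
  qed
  then show ?thesis unfolding length_set_def by blast
qed

lemma length_set_bounds:
  fixes A :: "'a::{finite, ab_group_add} multiset"
  assumes "k \<in> length_set A"
  shows "k \<le> size A" "size A \<le> CARD('a) * k"
proof -
  obtain F where F: "set_mset F \<subseteq> min_zero_sum_seqs" "sum_mset F = A" "size F = k"
    using assms unfolding length_set_def by blast
  have "size F \<le> size (sum_mset F) \<and> size (sum_mset F) \<le> CARD('a) * size F"
    using F(1)
  proof (induction F)
    case (add U F)
    then have "U \<in> min_zero_sum_seqs" by simp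
    then have "size U \<le> CARD('a)" "0 < size U"
      using size_min_zero_sum_le[of U]
      by (auto simp: min_zero_sum_seqs_def nonempty_has_size)
    with add show ?case by simp
  qed simp
  then show "k \<le> size A" "size A \<le> CARD('a) * k" using F by auto
qed

lemma finite_length_set: "finite (length_set (A :: 'a::{finite, ab_group_add} multiset))"
  by (rule finite_subset[of _ "{..size A}"]) (auto dest: length_set_bounds)

lemma bdd_above_elasticities:
  "bdd_above ((\<lambda>A. set_elasticity (length_set A)) `
     (zero_sum_seqs - {{#} :: 'a::{finite, ab_group_add} multiset}))"
proof (rule bdd_aboveI2)
  fix A :: "'a multiset" assume A: "A \<in> zero_sum_seqs - {{#}}"
  let ?L = "length_set A"
  have ne: "?L \<noteq> {}" using A length_set_nonempty by blast
  have "Max ?L \<in> ?L" "Min ?L \<in> ?L" using ne finite_length_set[of A] by auto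
  then have "Max ?L \<le> size A" "size A \<le> CARD('a) * Min ?L" using length_set_bounds by blast+
  moreover have "0 < size A" using A by (simp add: nonempty_has_size)
  ultimately have "Max ?L \<le> CARD('a) * Min ?L" "0 < Min ?L" by (auto intro: Nat.gr0I)
  then have "real (Max ?L) \<le> real (CARD('a)) * real (Min ?L)" "0 < real (Min ?L)"
    by (metis of_nat_le_iff of_nat_mult, simp)
  then show "set_elasticity ?L \<le> real (CARD('a))"
    unfolding set_elasticity_def by (simp add: divide_le_eq)
qed

end

theory Submission
  imports Defs
begin

text \<open>
  Write \<open>D\<close> for the Davenport constant; \<open>D \<ge> 3\<close> because the group has at least three elements.
  A sequence of length \<open>m\<close> with no term \<open>0\<close> is a product of at least \<open>m / D\<close> and at most
  \<open>m / 2\<close> atoms, and a term \<open>0\<close> lowers the ratio of the two extremes. Hence the elasticity is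
  \<open>D / 2\<close>, and the sequences that attain it are those which are at the same time a product of
  atoms of length \<open>D\<close> and a product of atoms of length \<open>2\<close> (\<open>max_elastic_iff\<close>). A pair of two
  such factorizations with equal product is a solution of a homogeneous linear system in natural
  numbers. Solutions are closed under differences, so by Dickson's lemma the minimal ones form a
  finite generating set. Thus the sequences of maximal elasticity form a finitely generated monoid
  \<open>M\<close> (\<open>max_elastic_finitely_generated\<close>).

  The first limit holds in every finitely generated monoid of multisets over a finite type. If
  \<open>B\<close> is large, some generator \<open>p\<close> occurs in \<open>B\<close> with a large multiplicity \<open>N\<close>, and removing
  \<open>0, 1, \<dots>, N - 1\<close> copies of \<open>p\<close> yields \<open>N\<close> elements of \<open>M\<close>. Since \<open>B\<close> ranges over a shell of
  bounded thickness, few choices lead to the same element, so the shell is a small fraction of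
  the ball (\<open>shell_bound\<close>).

  For the second limit it suffices to find one \<open>A \<in> M\<close> such that the length set of \<open>A + C\<close> is an
  interval for all \<open>C \<in> M\<close>: then at least as many good sequences have length at most \<open>n\<close> as
  elements of \<open>M\<close> have length at most \<open>n - |A|\<close>, and the first limit applies. Put
  \<open>W = U\<^sub>1 (-U\<^sub>1) U\<^sub>2 (-U\<^sub>2)\<close>. The relation between \<open>g\<^sub>1\<close>, \<open>g\<^sub>2\<close> and \<open>g\<^sub>1 + g\<^sub>2\<close> yields exchanges
  that change the shortest and the longest factorization of \<open>W\<close> by a single atom
  (\<open>exchange_lengths\<close>). Both ends of the length set of \<open>W\<close> thus contain two consecutive numbers,
  and a high power \<open>A\<close> of \<open>W\<close> has as length set a long interval from \<open>|A| / D\<close> to \<open>|A| / 2\<close>.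
  Multiplication by a generator moves the two ends of this interval by the shortest and the
  longest length of the generator, and leaves no gap as long as the interval is longer than every
  generator (\<open>interval_stable_under_generators\<close>).
\<close>

section \<open>Dickson's lemma\<close>

lemma nat_seq_mono_subseq:
  fixes s :: "nat \<Rightarrow> nat"
  shows "\<exists>r::nat \<Rightarrow> nat. strict_mono r \<and> mono (\<lambda>n. s (r n))"
proof -
  obtain f :: "nat \<Rightarrow> nat" where f: "strict_mono f" "monoseq (\<lambda>n. s (f n))"
    using seq_monosub[of s] by blast
  \<comment> \<open>A decreasing sequence of natural numbers is constant once it has reached its minimum.\<close>
  define N where "N = (ARG_MIN (\<lambda>n. s (f n)) n. True)"
  have N: "s (f N) \<le> s (f n)" for n
    unfolding N_def by (rule arg_min_nat_le) simp
  show ?thesis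
  proof (cases "incseq (\<lambda>n. s (f n))")
    case True
    then show ?thesis using f by (auto simp: mono_def)
  next
    case False
    then have dec: "decseq (\<lambda>n. s (f n))" using f(2) by (simp add: monoseq_iff)
    have const: "s (f (n + N)) = s (f N)" for n
      using N[of "n + N"] decseqD[OF dec, of N "n + N"] by simp
    have "strict_mono (\<lambda>n. f (n + N))"
      using f(1) by (simp add: strict_mono_def)
    then show ?thesis using const by (intro exI[of _ "\<lambda>n. f (n + N)"]) (simp add: mono_def)
  qed
qed

text \<open>Passing to a monotone subsequence for one element of \<open>I\<close> after the other makes all
  multiplicities monotone at once.\<close>

lemma dickson_subseq:
  fixes s :: "nat \<Rightarrow> 'i multiset"
  assumes "finite I" and "\<And>n. set_mset (s n) \<subseteq> I"
  shows "\<exists>r::nat \<Rightarrow> nat. strict_mono r \<and> (\<forall>m n. m \<le> n \<longrightarrow> s (r m) \<subseteq># s (r n))"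
proof -
  have "\<exists>r::nat \<Rightarrow> nat. strict_mono r \<and> (\<forall>i\<in>I. mono (\<lambda>n. count (s (r n)) i))"
    using assms(1)
  proof (induction I)
    case empty
    show ?case by (intro exI[of _ id]) (simp add: strict_mono_def)
  next
    case (insert i J)
    then obtain r :: "nat \<Rightarrow> nat" where r: "strict_mono r"
      "\<forall>j\<in>J. mono (\<lambda>n. count (s (r n)) j)" by blast
    obtain q :: "nat \<Rightarrow> nat" where q: "strict_mono q" "mono (\<lambda>n. count (s (r (q n))) i)"
      using nat_seq_mono_subseq[of "\<lambda>n. count (s (r n)) i"] by blast
    have "mono (\<lambda>n. count (s (r (q n))) j)" if "j \<in> J" for j
      using r(2) that strict_mono_mono[OF q(1)] by (simp add: mono_def)
    moreover have "strict_mono (\<lambda>n. r (q n))"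
      using r(1) q(1) by (simp add: strict_mono_def)
    ultimately show ?case using q(2) by (intro exI[of _ "\<lambda>n. r (q n)"]) simp
  qed
  then obtain r :: "nat \<Rightarrow> nat" where r: "strict_mono r"
    "\<forall>i\<in>I. mono (\<lambda>n. count (s (r n)) i)" by blast
  have "s (r m) \<subseteq># s (r n)" if "m \<le> n" for m n
  proof (rule mset_subset_eqI)
    fix i
    show "count (s (r m)) i \<le> count (s (r n)) i"
    proof (cases "i \<in> I")
      case True
      then show ?thesis using r(2) that by (simp add: mono_def)
    next
      case False
      then have "i \<notin># s (r m)" using assms(2) by blast
      then show ?thesis by (simp add: not_in_iff)
    qed
  qed
  then show ?thesis using r(1) by blast
qed

text \<open>The generators are the minimal nonempty members of \<open>X\<close>. They are pairwise incomparable, so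
  Dickson's lemma makes them finite in number; a member that is not minimal splits into two smaller
  members because \<open>X\<close> is closed under differences.\<close>

lemma finitely_generated_if_difference_closed:
  fixes X :: "'i multiset set"
  assumes I: "finite I" "\<And>K. K \<in> X \<Longrightarrow> set_mset K \<subseteq> I"
    and diff: "\<And>J K. J \<in> X \<Longrightarrow> J + K \<in> X \<Longrightarrow> K \<in> X"
  obtains P where "finite P" "P \<subseteq> X" "\<forall>K\<in>X. \<exists>Q. set_mset Q \<subseteq> P \<and> sum_mset Q = K"
proof
  define P where "P = {K \<in> X. K \<noteq> {#} \<and> (\<forall>J\<in>X. J \<subseteq># K \<longrightarrow> J = {#} \<or> J = K)}"
  show "P \<subseteq> X" unfolding P_def by blast
  show "finite P"
  proof (rule ccontr)
    assume "infinite P"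
    then obtain s :: "nat \<Rightarrow> 'i multiset" where s: "inj s" "range s \<subseteq> P"
      using infinite_countable_subset by blast
    then have "\<And>n. set_mset (s n) \<subseteq> I" using I(2) unfolding P_def by blast
    from dickson_subseq[OF I(1) this] obtain r :: "nat \<Rightarrow> nat"
      where r: "strict_mono r \<and> (\<forall>m n. m \<le> n \<longrightarrow> s (r m) \<subseteq># s (r n))" ..
    have "s (r 0) \<subseteq># s (r 1)" by (rule r[THEN conjunct2, rule_format]) simp
    moreover have "s (r 0) \<in> P" "s (r 1) \<in> P" using s(2) by auto
    ultimately have "s (r 0) = s (r 1)" unfolding P_def by blast
    then have "r 0 = r 1" using s(1) by (simp add: inj_eq)
    then show False using strict_mono_eq[OF conjunct1[OF r], of 0 1] by simp
  qed
  have "\<exists>Q. set_mset Q \<subseteq> P \<and> sum_mset Q = K" if "K \<in> X" for K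
    using that
  proof (induction "size K" arbitrary: K rule: less_induct)
    case less
    consider "K = {#}" | "K \<in> P" | J where "J \<in> X" "J \<subseteq># K" "J \<noteq> {#}" "J \<noteq> K"
      using less.prems unfolding P_def by blast
    then show ?case
    proof cases
      case 1
      then show ?thesis by (intro exI[of _ "{#}"]) simp
    next
      case 2
      then show ?thesis by (intro exI[of _ "{#K#}"]) simp
    next
      case 3
      define J' where "J' = K - J"
      have K: "K = J + J'" using 3(2) unfolding J'_def by simp
      then have "J' \<in> X" using diff[of J J'] 3(1) less.prems by simp
      moreover have "J' \<noteq> {#}" using K 3(4) by auto
      then have "size J < size K" "size J' < size K"
        using K 3(3) by (simp_all add: nonempty_has_size)
      ultimately obtain Q Q' where "set_mset Q \<subseteq> P" "sum_mset Q = J"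
        "set_mset Q' \<subseteq> P" "sum_mset Q' = J'"
        using less.hyps 3(1) by meson
      then show ?thesis using K by (intro exI[of _ "Q + Q'"]) simp
    qed
  qed
  then show "\<forall>K\<in>X. \<exists>Q. set_mset Q \<subseteq> P \<and> sum_mset Q = K" by blast
qed

section \<open>Growth of finitely generated monoids of multisets\<close>

lemma size_sum_mset_le:
  fixes F :: "'b multiset multiset"
  assumes "\<And>U. U \<in># F \<Longrightarrow> size U \<le> c"
  shows "size (sum_mset F) \<le> c * size F"
  using assms
proof (induction F)
  case (add U F)
  then have "size U \<le> c" "size (sum_mset F) \<le> c * size F" by auto
  then show ?case by simp
qed simp

lemma size_sum_mset_ge:
  fixes F :: "'b multiset multiset"
  assumes "\<And>U. U \<in># F \<Longrightarrow> c \<le> size U"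
  shows "c * size F \<le> size (sum_mset F)"
  using assms
proof (induction F)
  case (add U F)
  then have "c \<le> size U" "c * size F \<le> size (sum_mset F)" by auto
  then show ?case by simp
qed simp

text \<open>A single member below the bound \<open>c\<close> could not be compensated by the others; likewise for
  lower bounds.\<close>

lemma sizes_eq_if_sum_max:
  fixes F :: "'b multiset multiset"
  assumes "\<And>U. U \<in># F \<Longrightarrow> size U \<le> c" "size (sum_mset F) = c * size F" "U \<in># F"
  shows "size U = c"
proof -
  obtain F' where F': "F = add_mset U F'" using assms(3) by (metis mset_add)
  have "size (sum_mset F') \<le> c * size F'" using assms(1) F' by (intro size_sum_mset_le) auto
  moreover have "size U \<le> c" using assms by blast
  ultimately show ?thesis using assms(2) F' by simp
qed

lemma sizes_eq_if_sum_min: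
  fixes F :: "'b multiset multiset"
  assumes "\<And>U. U \<in># F \<Longrightarrow> c \<le> size U" "size (sum_mset F) = c * size F" "U \<in># F"
  shows "size U = c"
proof -
  obtain F' where F': "F = add_mset U F'" using assms(3) by (metis mset_add)
  have "c * size F' \<le> size (sum_mset F')" using assms(1) F' by (intro size_sum_mset_ge) auto
  moreover have "c \<le> size U" using assms by blast
  ultimately show ?thesis using assms(2) F' by simp
qed

lemma size_eq_sum_count:
  assumes "finite P" "set_mset Q \<subseteq> P"
  shows "size Q = (\<Sum>p\<in>P. count Q p)"
  unfolding size_multiset_overloaded_eq
  using assms by (intro sum.mono_neutral_left) (auto simp: not_in_iff)

locale finitely_generated =
  fixes M P :: "'a::finite multiset set"
  assumes empty_mem: "{#} \<in> M"
    and add_mem: "A \<in> M \<Longrightarrow> B \<in> M \<Longrightarrow> A + B \<in> M"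
    and finite_gens: "finite P"
    and gens_mem: "P \<subseteq> M"
    and gens_nonempty: "{#} \<notin> P"
    and generates: "B \<in> M \<Longrightarrow> \<exists>Q. set_mset Q \<subseteq> P \<and> sum_mset Q = B"
begin

lemma sum_mset_mem: "set_mset Q \<subseteq> P \<Longrightarrow> sum_mset Q \<in> M"
  using gens_mem by (induction Q) (auto intro: empty_mem add_mem)

lemma repeat_mem: "A \<in> M \<Longrightarrow> repeat_mset k A \<in> M"
  by (induction k) (auto intro: empty_mem add_mem)

lemma finite_ball: "finite {B \<in> M. size B \<le> n}"
  by (rule finite_subset[OF _ finite_size_le[of n]]) auto

text \<open>A large element is a sum of many generators, and the pigeonhole principle makes one of them
  occur \<open>N\<close> times.\<close>

lemma repeated_generator:
  assumes B: "B \<in> M" and C: "\<And>p. p \<in> P \<Longrightarrow> size p \<le> C"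
    and big: "C * (card P * N) < size B"
  obtains p R where "p \<in> P" "R \<in> M" "B = repeat_mset N p + R"
proof -
  obtain Q where Q: "set_mset Q \<subseteq> P" "sum_mset Q = B" using generates[OF B] by blast
  have "size B \<le> C * size Q" using size_sum_mset_le[of Q C] Q C by auto
  then have "card P * N < size Q"
    using big by (metis le_trans mult_le_mono2 not_le)
  have "\<exists>p\<in>P. N \<le> count Q p"
  proof (rule ccontr)
    assume "\<not> (\<exists>p\<in>P. N \<le> count Q p)"
    then have "(\<Sum>p\<in>P. count Q p) \<le> card P * N"
      using sum_bounded_above[of P "count Q" N] by force
    then show False using size_eq_sum_count[OF finite_gens Q(1)] \<open>card P * N < size Q\<close> by simp
  qed
  then obtain p where p: "p \<in> P" "N \<le> count Q p" by blast
  then obtain Q' where Q': "Q = replicate_mset N p + Q'"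
    by (metis count_le_replicate_mset_subset_eq subset_mset.add_diff_inverse)
  have "sum_mset (replicate_mset N p) = repeat_mset N p"
    by (induction N) auto
  then have "B = repeat_mset N p + sum_mset Q'" using Q(2) Q' by simp
  moreover have "sum_mset Q' \<in> M" using Q(1) Q' by (intro sum_mset_mem) auto
  ultimately show thesis using that p(1) by blast
qed

text \<open>Fix a generator \<open>p\<close> and let \<open>B\<close> range over those elements of the shell from which \<open>N\<close> copies
  of \<open>p\<close> can be removed. The pair \<open>(B, j)\<close> with \<open>j < N\<close> can be recovered from the element
  \<open>B - j p\<close> of the ball and the depth \<open>n - |B| < a\<close> of \<open>B\<close> in the shell, because \<open>p\<close> is nonempty.
  This bounds \<open>N\<close> times the number of such \<open>B\<close>.\<close>

lemma shell_bound:
  assumes C: "\<And>p. p \<in> P \<Longrightarrow> size p \<le> C" and n: "a + C * (card P * N) \<le> n"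
  shows "N * card {B \<in> M. n - a < size B \<and> size B \<le> n}
           \<le> card P * (a * card {B \<in> M. size B \<le> n})"
proof -
  define ball where "ball = {B \<in> M. size B \<le> n}"
  define shell where "shell p = {B \<in> ball. n - a < size B \<and> (\<exists>R\<in>M. B = repeat_mset N p + R)}" for p
  have fin: "finite ball" unfolding ball_def by (rule finite_ball)
  then have fin': "finite (shell p)" for p unfolding shell_def by simp
  have one: "N * card (shell p) \<le> a * card ball" if p: "p \<in> P" for p
  proof -
    define f where "f = (\<lambda>(B, j). (B - repeat_mset j p, n - size B))"
    have sub: "\<exists>R'\<in>M. B = repeat_mset j p + R'" if "B \<in> shell p" "j < N" for B j
    proof -
      obtain R where R: "R \<in> M" "B = repeat_mset N p + R" using \<open>B \<in> shell p\<close> unfolding shell_def by blast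
      have "repeat_mset N p = repeat_mset j p + repeat_mset (N - j) p"
        using that(2) by (intro multiset_eqI) (simp flip: distrib_right)
      moreover have "repeat_mset (N - j) p + R \<in> M"
        using R(1) p gens_mem by (blast intro: add_mem repeat_mem)
      ultimately show ?thesis using R(2) by (auto simp: add.assoc)
    qed
    have "inj_on f (shell p \<times> {..<N})"
    proof (rule inj_onI, clarify)
      fix B j B' j'
      assume B: "B \<in> shell p" "j < N" and B': "B' \<in> shell p" "j' < N"
        and eq: "f (B, j) = f (B', j')"
      obtain R R' where R: "B = repeat_mset j p + R" "B' = repeat_mset j' p + R'"
        using sub[OF B] sub[OF B'] by blast
      have "R = R'" "n - size B = n - size B'" using eq R unfolding f_def by auto
      moreover have "size B \<le> n" "size B' \<le> n"
        using B(1) B'(1) unfolding shell_def ball_def by auto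
      ultimately have "size B = size B'" by linarith
      then have "j * size p = j' * size p" using R \<open>R = R'\<close> by simp
      moreover have "size p \<noteq> 0" using p gens_nonempty by auto
      ultimately have "j = j'" by simp
      then show "B = B' \<and> j = j'" using R \<open>R = R'\<close> by simp
    qed
    moreover have "f ` (shell p \<times> {..<N}) \<subseteq> ball \<times> {..<a}"
    proof (rule image_subsetI, clarify)
      fix B j assume B: "B \<in> shell p" and j: "j < N"
      obtain R where "R \<in> M" "B = repeat_mset j p + R" using sub[OF B j] by blast
      moreover have "size B \<le> n" "n - a < size B" using B unfolding shell_def ball_def by auto
      ultimately show "f (B, j) \<in> ball \<times> {..<a}"
        unfolding f_def ball_def by auto
    qed
    ultimately have "card (shell p \<times> {..<N}) \<le> card (ball \<times> {..<a})"
      using fin by (intro card_inj_on_le) auto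
    then show ?thesis by (simp add: card_cartesian_product mult.commute)
  qed
  have "{B \<in> M. n - a < size B \<and> size B \<le> n} \<subseteq> (\<Union>p\<in>P. shell p)"
  proof
    fix B assume B: "B \<in> {B \<in> M. n - a < size B \<and> size B \<le> n}"
    then have "C * (card P * N) < size B" using n by (simp, linarith)
    then obtain p R where "p \<in> P" "R \<in> M" "B = repeat_mset N p + R"
      using repeated_generator[of B C N] B C by blast
    then show "B \<in> (\<Union>p\<in>P. shell p)" using B unfolding shell_def ball_def by blast
  qed
  then have "card {B \<in> M. n - a < size B \<and> size B \<le> n} \<le> card (\<Union>p\<in>P. shell p)"
    using finite_gens fin' by (intro card_mono) auto
  also have "\<dots> \<le> (\<Sum>p\<in>P. card (shell p))" by (rule card_UN_le[OF finite_gens])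
  finally have "N * card {B \<in> M. n - a < size B \<and> size B \<le> n} \<le> (\<Sum>p\<in>P. N * card (shell p))"
    by (simp flip: sum_distrib_left)
  also have "\<dots> \<le> card P * (a * card ball)"
    using sum_bounded_above[of P "\<lambda>p. N * card (shell p)" "a * card ball"] one by simp
  finally show ?thesis unfolding ball_def .
qed

lemma ball_ratio_tendsto_1:
  "(\<lambda>n. real (card {B \<in> M. int (size B) \<le> int n - int a}) / real (card {B \<in> M. size B \<le> n}))
     \<longlonglongrightarrow> 1"
proof (rule LIMSEQ_I)
  fix e :: real assume e: "0 < e"
  define C where "C = (\<Sum>p\<in>P. size p)"
  have C: "size p \<le> C" if "p \<in> P" for p
    unfolding C_def using that finite_gens by (simp add: member_le_sum)
  obtain N :: nat where N: "real (card P * a) / e < real N" using reals_Archimedean2 by blast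
  have "norm (real (card {B \<in> M. int (size B) \<le> int n - int a}) / real (card {B \<in> M. size B \<le> n}) - 1) < e"
    if n: "n \<ge> a + C * (card P * N)" for n
  proof -
    define b where "b = card {B \<in> M. size B \<le> n}"
    define c where "c = card {B \<in> M. size B \<le> n - a}"
    define s where "s = card {B \<in> M. n - a < size B \<and> size B \<le> n}"
    have "{B \<in> M. size B \<le> n} = {B \<in> M. size B \<le> n - a} \<union> {B \<in> M. n - a < size B \<and> size B \<le> n}"
      by auto
    moreover have "finite {B \<in> M. n - a < size B \<and> size B \<le> n}"
      by (rule finite_subset[OF _ finite_ball[of n]]) auto
    ultimately have bcs: "b = c + s"
      unfolding b_def c_def s_def using finite_ball by (auto intro: card_Un_disjoint)
    have "{#} \<in> {B \<in> M. size B \<le> n}" using empty_mem by simp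
    then have b: "0 < b" unfolding b_def using finite_ball card_gt_0_iff by blast
    have "N * s \<le> card P * (a * b)" unfolding s_def b_def by (rule shell_bound[OF C n])
    then have "real N * real s \<le> real (card P * a) * real b"
      by (metis mult.assoc of_nat_le_iff of_nat_mult)
    also have "\<dots> < (e * real N) * real b"
      using N e b by (intro mult_strict_right_mono) (auto simp: field_simps)
    finally have "real N * real s < real N * (e * real b)" by (simp add: mult_ac)
    then have "real s < e * real b" by (rule mult_left_less_imp_less) simp
    then have "real s / real b < e" using b by (simp add: field_simps)
    moreover have "real c = real b - real s" using bcs by simp
    then have "real c / real b - 1 = - (real s / real b)" using b by (simp add: diff_divide_distrib)
    moreover have "{B \<in> M. int (size B) \<le> int n - int a} = {B \<in> M. size B \<le> n - a}"
      using n by auto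
    ultimately show ?thesis by (simp flip: c_def b_def)
  qed
  then show "\<exists>n0. \<forall>n\<ge>n0. norm (real (card {B \<in> M. int (size B) \<le> int n - int a}) /
      real (card {B \<in> M. size B \<le> n}) - 1) < e" by blast
qed

text \<open>Translation by \<open>A\<close> embeds the ball of radius \<open>n - |A|\<close> into the set of elements of the ball of
  radius \<open>n\<close> with property \<open>Q\<close>.\<close>

lemma absorbing_ratio_tendsto_1:
  assumes A: "A \<in> M" and Q: "\<And>C. C \<in> M \<Longrightarrow> Q (A + C)"
  shows "(\<lambda>n. real (card {B \<in> M. size B \<le> n \<and> Q B}) / real (card {B \<in> M. size B \<le> n}))
     \<longlonglongrightarrow> 1"
proof (rule tendsto_sandwich[OF _ _ ball_ratio_tendsto_1[of "size A"] tendsto_const])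
  have fin: "finite {B \<in> M. size B \<le> n \<and> Q B}" for n
    by (rule finite_subset[OF _ finite_ball[of n]]) auto
  have "card {B \<in> M. int (size B) \<le> int n - int (size A)} \<le> card {B \<in> M. size B \<le> n \<and> Q B}" for n
    using A Q add_mem by (intro card_inj_on_le[OF _ _ fin, of "(+) A"]) (auto simp: inj_on_def)
  then show "\<forall>\<^sub>F n in sequentially.
      real (card {B \<in> M. int (size B) \<le> int n - int (size A)}) / real (card {B \<in> M. size B \<le> n})
      \<le> real (card {B \<in> M. size B \<le> n \<and> Q B}) / real (card {B \<in> M. size B \<le> n})"
    by (intro always_eventually allI divide_right_mono) auto
  have "card {B \<in> M. size B \<le> n \<and> Q B} \<le> card {B \<in> M. size B \<le> n}" for n
    by (intro card_mono finite_ball) auto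
  then show "\<forall>\<^sub>F n in sequentially.
      real (card {B \<in> M. size B \<le> n \<and> Q B}) / real (card {B \<in> M. size B \<le> n}) \<le> 1"
    by (intro always_eventually allI) (auto simp: divide_le_eq_1)
qed

end

section \<open>Atoms and length sets\<close>

lemma min_zero_sum_seqsD:
  assumes "U \<in> min_zero_sum_seqs"
  shows "sum_mset U = 0" "U \<noteq> {#}"
    "\<And>S T. U = S + T \<Longrightarrow> sum_mset S = 0 \<Longrightarrow> S \<noteq> {#} \<Longrightarrow> T = {#}"
proof -
  show 0: "sum_mset U = 0" "U \<noteq> {#}"
    using assms unfolding min_zero_sum_seqs_def zero_sum_seqs_def by auto
  show "T = {#}" if "U = S + T" "sum_mset S = 0" "S \<noteq> {#}" for S T
  proof -
    have "sum_mset T = 0" using 0 that by simp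
    then show ?thesis using assms that unfolding min_zero_sum_seqs_def zero_sum_seqs_def by blast
  qed
qed

lemma min_zero_sum_seqsI:
  assumes "sum_mset U = 0" "U \<noteq> {#}"
    and "\<And>S T. U = S + T \<Longrightarrow> sum_mset S = 0 \<Longrightarrow> sum_mset T = 0 \<Longrightarrow> S \<noteq> {#} \<Longrightarrow> T = {#}"
  shows "U \<in> min_zero_sum_seqs"
  using assms unfolding min_zero_sum_seqs_def zero_sum_seqs_def by blast

lemma no_zero_in_long_atom:
  assumes U: "U \<in> min_zero_sum_seqs" and "2 \<le> size U"
  shows "0 \<notin># U"
proof
  assume "0 \<in># U"
  then obtain T where "U = add_mset 0 T" by (metis mset_add)
  then have T: "U = {#0#} + T" by simp
  then have "T = {#}" using min_zero_sum_seqsD(3)[OF U T] by simp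
  then show False using T assms(2) by simp
qed

lemma no_zero_two_le_size:
  assumes "0 \<notin># S" "S \<noteq> {#}" "sum_mset S = 0"
  shows "2 \<le> size S"
proof (rule ccontr)
  assume "\<not> 2 \<le> size S"
  moreover have "size S \<noteq> 0" using assms(2) by simp
  ultimately have "size S = 1" by linarith
  then obtain g where "S = {#g#}" using size_1_singleton_mset by blast
  then show False using assms by simp
qed

text \<open>A decomposition of a zero-sum sequence of length at most three would have a part of
  length one, whose only term would be \<open>0\<close>.\<close>

lemma short_zero_sum_atom:
  assumes "0 \<notin># U" "U \<noteq> {#}" "sum_mset U = 0" "size U \<le> 3"
  shows "U \<in> min_zero_sum_seqs"
proof (rule min_zero_sum_seqsI)
  fix S T assume "U = S + T" "sum_mset S = 0" "sum_mset T = 0" "S \<noteq> {#}"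
  then show "T = {#}"
    using assms no_zero_two_le_size[of S] no_zero_two_le_size[of T] by (cases "T = {#}") auto
qed (use assms in auto)

lemma length_setI: "set_mset F \<subseteq> min_zero_sum_seqs \<Longrightarrow> sum_mset F = A \<Longrightarrow> size F \<in> length_set A"
  unfolding length_set_def by blast

lemma length_setE:
  assumes "k \<in> length_set A"
  obtains F where "set_mset F \<subseteq> min_zero_sum_seqs" "sum_mset F = A" "size F = k"
  using assms unfolding length_set_def by blast

lemma length_set_empty: "0 \<in> length_set {#}"
  using length_setI[of "{#}"] by simp

lemma length_set_atom: "U \<in> min_zero_sum_seqs \<Longrightarrow> 1 \<in> length_set U"
  using length_setI[of "{#U#}"] by simp

lemma length_set_add:
  assumes "k \<in> length_set A" "l \<in> length_set B"
  shows "k + l \<in> length_set (A + B)"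
proof -
  obtain F where F: "set_mset F \<subseteq> min_zero_sum_seqs" "sum_mset F = A" "size F = k"
    using assms(1) by (rule length_setE)
  obtain H where "set_mset H \<subseteq> min_zero_sum_seqs" "sum_mset H = B" "size H = l"
    using assms(2) by (rule length_setE)
  with F show ?thesis using length_setI[of "F + H" "A + B"] by simp
qed

lemma length_set_zero_sum:
  assumes "k \<in> length_set A" shows "sum_mset A = 0"
proof -
  obtain F where F: "set_mset F \<subseteq> min_zero_sum_seqs" "sum_mset F = A"
    using assms unfolding length_set_def by blast
  have "sum_mset (sum_mset F) = 0" using F(1)
    by (induction F) (auto dest: min_zero_sum_seqsD(1))
  then show ?thesis using F(2) by simp
qed

lemma sum_mset_uminus: "sum_mset (image_mset uminus A) = - sum_mset (A :: 'a::ab_group_add multiset)"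
  by (induction A) auto

lemma image_uminus_uminus: "image_mset uminus (image_mset uminus A) = (A :: 'a::ab_group_add multiset)"
  by (simp add: multiset.map_comp comp_def)

lemma uminus_atom:
  assumes U: "U \<in> min_zero_sum_seqs"
  shows "image_mset uminus U \<in> min_zero_sum_seqs"
proof (rule min_zero_sum_seqsI)
  fix S T assume eq: "image_mset uminus U = S + T" and S: "sum_mset S = 0" "S \<noteq> {#}"
  have "U = image_mset uminus S + image_mset uminus T"
    using arg_cong[OF eq, of "image_mset uminus"] by (simp add: image_uminus_uminus)
  from min_zero_sum_seqsD(3)[OF U this] show "T = {#}"
    using S by (simp add: sum_mset_uminus)
qed (use min_zero_sum_seqsD[OF U] in \<open>auto simp: sum_mset_uminus\<close>)

text \<open>Each term is paired with its inverse.\<close>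

lemma length_set_symmetric:
  assumes "0 \<notin># T"
  shows "size T \<in> length_set (T + image_mset uminus T)"
  using assms
proof (induction T)
  case empty
  show ?case using length_set_empty by simp
next
  case (add g T)
  have "{#g, - g#} \<in> min_zero_sum_seqs"
    using add.prems by (intro short_zero_sum_atom) auto
  from length_set_add[OF length_set_atom[OF this] add.IH] show ?case
    using add.prems by (simp add: add_mset_commute)
qed

text \<open>Each term of \<open>Z\<close> lies in the way of at most one member of \<open>F\<close>, and there are fewer terms
  than members. Applied to a zero-sum free \<open>R\<close> this bounds the number of factors in a
  factorization of \<open>Z + R\<close>.\<close>

lemma avoiding_member:
  fixes F :: "'b multiset multiset"
  assumes "sum_mset F \<subseteq># Z + R" "size Z < size F"
  shows "\<exists>S\<in>#F. S \<subseteq># R"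
  using assms
proof (induction Z arbitrary: F)
  case empty
  then obtain S F' where "F = add_mset S F'" by (metis multiset_nonemptyE mset_add size_empty less_irrefl)
  then have "S \<in># F" "S \<subseteq># sum_mset F" by auto
  then show ?case using empty.prems(1) subset_mset.order_trans by fastforce
next
  case (add z Z)
  show ?case
  proof (cases "z \<in># sum_mset F")
    case True
    then obtain S where S: "S \<in># F" "z \<in># S" by (auto simp: in_Union_mset_iff)
    then obtain F' where F': "F = add_mset S F'" by (metis mset_add)
    obtain S' where S': "S = add_mset z S'" using S(2) by (metis mset_add)
    have "add_mset z (S' + sum_mset F') \<subseteq># add_mset z (Z + R)"
      using add.prems(1) F' S' by simp
    then have "S' + sum_mset F' \<subseteq># Z + R" by simp
    then have "sum_mset F' \<subseteq># Z + R"
      using subset_mset.order_trans[OF mset_subset_eq_add_right] by blast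
    moreover have "size Z < size F'" using add.prems(2) F' by simp
    ultimately obtain S0 where "S0 \<in># F'" "S0 \<subseteq># R" using add.IH by blast
    then show ?thesis using F' by auto
  next
    case False
    then have "sum_mset F \<subseteq># Z + R"
      using add.prems(1) by (metis add_mset_add_single diff_single_trivial subset_eq_diff_conv union_mset_add_mset_left)
    then show ?thesis using add.IH add.prems(2) by simp
  qed
qed

section \<open>Intervals in length sets\<close>

text \<open>The translates of \<open>{a..b}\<close> by \<open>l\<close> and by \<open>h\<close> overlap or touch.\<close>

lemma length_set_interval_absorb:
  assumes A: "{a..b} \<subseteq> length_set A" "a \<le> b"
    and B: "l \<in> length_set B" "h \<in> length_set B" "l \<le> h" "h - l \<le> Suc (b - a)"
  shows "{a + l..b + h} \<subseteq> length_set (A + B)"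
proof
  fix x assume x: "x \<in> {a + l..b + h}"
  show "x \<in> length_set (A + B)"
  proof (cases "x \<le> b + l")
    case True
    then have "x - l \<in> {a..b}" using x by auto
    then have "x - l \<in> length_set A" using A(1) by blast
    from length_set_add[OF this B(1)] show ?thesis using x by simp
  next
    case False
    then have "x - h \<in> {a..b}" "h \<le> x" using A(2) B(3,4) x by auto
    then have "x - h \<in> length_set A" using A(1) by blast
    from length_set_add[OF this B(2)] show ?thesis using \<open>h \<le> x\<close> by simp
  qed
qed

lemma length_set_interval_repeat:
  assumes "l \<in> length_set B" "Suc l \<in> length_set B"
  shows "{k * l..k * Suc l} \<subseteq> length_set (repeat_mset k B)"
proof (induction k)
  case 0
  then show ?case using length_set_empty by simp
next
  case (Suc k)
  have "{k * l + l..k * Suc l + Suc l} \<subseteq> length_set (repeat_mset k B + B)"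
    by (rule length_set_interval_absorb[OF Suc _ assms]) auto
  then show ?case by (simp add: ac_simps)
qed

lemma length_set_interval_add:
  assumes A: "{a..b} \<subseteq> length_set A" "a \<le> b" and B: "{c..d} \<subseteq> length_set B" "c \<le> d"
  shows "{a + c..b + d} \<subseteq> length_set (A + B)"
proof
  fix x assume x: "x \<in> {a + c..b + d}"
  define y where "y = min b (x - c)"
  have "y \<in> {a..b}" "x - y \<in> {c..d}" "y \<le> x" using x assms(2,4) unfolding y_def by auto
  then have "y + (x - y) \<in> length_set (A + B)" using A(1) B(1) by (intro length_set_add) auto
  then show "x \<in> length_set (A + B)" using \<open>y \<le> x\<close> by simp
qed

text \<open>Let \<open>a\<close> copies of \<open>B\<close> contribute the length \<open>l\<close> or \<open>l + 1\<close> and the other \<open>b = k - a\<close> copies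
  the length \<open>h\<close> or \<open>h + 1\<close>. The resulting lengths form an interval with \<open>k + 1\<close> elements.
  Replacing \<open>a\<close> by \<open>a - 1\<close> moves it by \<open>h - l\<close>, which is too little to open a gap.\<close>

lemma length_set_repeat_full:
  assumes B: "l \<in> length_set B" "Suc l \<in> length_set B" "h \<in> length_set B" "Suc h \<in> length_set B"
    and k: "h \<le> Suc (k + l)"
  shows "{k * l..k * Suc h} \<subseteq> length_set (repeat_mset k B)"
proof -
  have "{k * l..a * Suc l + b * Suc h} \<subseteq> length_set (repeat_mset k B)" if "a + b = k" for a b
    using that
  proof (induction b arbitrary: a)
    case 0
    then show ?case using length_set_interval_repeat[OF B(1,2), of k] by simp
  next
    case (Suc b)
    let ?x = "a * l + Suc b * h" and ?y = "a * Suc l + Suc b * Suc h" and ?z = "Suc a * Suc l + b * Suc h"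
    have "{?x..?y} \<subseteq> length_set (repeat_mset a B + repeat_mset (Suc b) B)"
      using B by (intro length_set_interval_add length_set_interval_repeat) auto
    also have "repeat_mset a B + repeat_mset (Suc b) B = repeat_mset k B"
      using Suc.prems by (metis repeat_mset_distrib)
    finally have "{?x..?y} \<subseteq> length_set (repeat_mset k B)" .
    moreover have "{k * l..?z} \<subseteq> length_set (repeat_mset k B)"
      using Suc.IH[of "Suc a"] Suc.prems by simp
    moreover have "?x \<le> Suc ?z" using k Suc.prems by (simp add: algebra_simps)
    then have "{k * l..?y} \<subseteq> {?x..?y} \<union> {k * l..?z}" by (auto simp del: mult_Suc mult_Suc_right)
    ultimately show ?case by blast
  qed
  from this[of 0 k] show ?thesis by simp
qed

section \<open>The Davenport constant and sequences of maximal elasticity\<close>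

lemma three_term_atom:
  fixes g h :: "'a::ab_group_add"
  assumes "g \<noteq> 0" "h \<noteq> 0" "g + h \<noteq> 0"
  shows "{#g, h, - (g + h)#} \<in> min_zero_sum_seqs"
  using assms by (intro short_zero_sum_atom) (auto simp: neg_eq_iff_add_eq_0 add.commute)

context
  fixes D :: nat
  assumes card_ge_3: "CARD('a::{finite, ab_group_add}) \<ge> 3"
    and D_eq: "D = davenport TYPE('a)"
begin

lemma finite_atom_sizes: "finite {size U | U :: 'a multiset. U \<in> min_zero_sum_seqs}"
  using finite_imageI[OF finite_min_zero_sum_seqs, of size] by (simp add: setcompr_eq_image)

lemma atom_size_le: "(U :: 'a multiset) \<in> min_zero_sum_seqs \<Longrightarrow> size U \<le> D"
  unfolding D_eq davenport_def by (rule Max_ge[OF finite_atom_sizes]) blast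

text \<open>Take \<open>g \<noteq> 0\<close>, and \<open>h\<close> different from \<open>0\<close> and \<open>- g\<close>; this is where three group elements are
  needed.\<close>

lemma ex_three_term_atom: "\<exists>U :: 'a multiset. U \<in> min_zero_sum_seqs \<and> size U = 3"
proof -
  have avoid: "\<exists>x::'a. x \<notin> {a, b}" for a b
  proof (rule ccontr)
    assume "\<nexists>x. x \<notin> {a, b}"
    then have "(UNIV :: 'a set) = {a, b}" by auto
    moreover have "card {a, b} \<le> 2" by (simp add: card_insert_if)
    ultimately have "CARD('a) \<le> 2" by simp
    then show False using card_ge_3 by simp
  qed
  obtain g :: 'a where g: "g \<noteq> 0" using avoid[of 0 0] by auto
  obtain h where "h \<noteq> 0" "h \<noteq> - g" using avoid[of 0 "- g"] by auto
  then have "{#g, h, - (g + h)#} \<in> min_zero_sum_seqs"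
    using g by (intro three_term_atom) (auto simp: add_eq_0_iff)
  then show ?thesis by fastforce
qed

lemma D_ge_3: "3 \<le> D"
  using ex_three_term_atom atom_size_le by metis

lemma ex_longest_atom: "\<exists>U :: 'a multiset. U \<in> min_zero_sum_seqs \<and> size U = D"
proof -
  have "D \<in> {size U | U :: 'a multiset. U \<in> min_zero_sum_seqs}"
    unfolding D_eq davenport_def using ex_three_term_atom by (intro Max_in[OF finite_atom_sizes]) blast
  then show ?thesis by auto
qed

text \<open>The atom \<open>0\<close> occurs in every factorization of \<open>A\<close> exactly as often as \<open>0\<close> occurs in
  \<open>A\<close>; all other atoms have between \<open>2\<close> and \<open>D\<close> terms.\<close>

lemma length_bounds_with_zeros:
  assumes "k \<in> length_set (A :: 'a multiset)"
  shows "2 * k \<le> size A + count A 0" "size A + (D - 1) * count A 0 \<le> D * k"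
proof -
  obtain F where F: "set_mset F \<subseteq> min_zero_sum_seqs" "sum_mset F = A" "size F = k"
    using assms unfolding length_set_def by blast
  have one: "2 \<le> size U + count U 0 \<and> size U + (D - 1) * count U 0 \<le> D"
    if "U \<in> min_zero_sum_seqs" for U :: "'a multiset"
  proof (cases "2 \<le> size U")
    case True
    then have "count U 0 = 0" using no_zero_in_long_atom[OF that] by (simp add: not_in_iff)
    then show ?thesis using True atom_size_le[OF that] by simp
  next
    case False
    then have "0 \<in># U" using no_zero_two_le_size[of U] min_zero_sum_seqsD[OF that] by blast
    then obtain T where "U = add_mset 0 T" by (metis mset_add)
    then have "U = {#0#}" using False by (cases T) auto
    then show ?thesis using D_ge_3 by simp
  qed
  have "2 * size F \<le> size (sum_mset F) + count (sum_mset F) 0 \<and>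
    size (sum_mset F) + (D - 1) * count (sum_mset F) 0 \<le> D * size F" using F(1)
  proof (induction F)
    case (add U F)
    then have "2 * size F \<le> size (sum_mset F) + count (sum_mset F) 0 \<and>
      size (sum_mset F) + (D - 1) * count (sum_mset F) 0 \<le> D * size F"
      "2 \<le> size U + count U 0 \<and> size U + (D - 1) * count U 0 \<le> D" using one by auto
    then show ?case by (simp add: algebra_simps)
  qed simp
  then show "2 * k \<le> size A + count A 0" "size A + (D - 1) * count A 0 \<le> D * k"
    using F by auto
qed

lemma size_le_D_mult: "k \<in> length_set (A :: 'a multiset) \<Longrightarrow> size A \<le> D * k"
  using length_bounds_with_zeros(2) by fastforce

lemma size_ge_2_mult:
  assumes "k \<in> length_set (A :: 'a multiset)" "0 \<notin># A"
  shows "2 * k \<le> size A"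
  using length_bounds_with_zeros(1)[OF assms(1)] assms(2) by (simp add: not_in_iff)

lemma no_zero_if_D_mult:
  assumes "l \<in> length_set (A :: 'a multiset)" "D * l = size A"
  shows "0 \<notin># A"
proof -
  have "(D - 1) * count A 0 = 0" using length_bounds_with_zeros(2)[OF assms(1)] assms(2) by linarith
  then have "count A 0 = 0" using D_ge_3 by simp
  then show ?thesis by (simp add: not_in_iff)
qed

lemma Max_Min_length_set:
  assumes "(A :: 'a multiset) \<in> zero_sum_seqs"
  shows "Max (length_set A) \<in> length_set A" "Min (length_set A) \<in> length_set A"
  using finite_length_set[of A] length_set_nonempty[OF assms] by auto

lemma Min_length_set_pos:
  assumes "(A :: 'a multiset) \<in> zero_sum_seqs" "A \<noteq> {#}"
  shows "0 < Min (length_set A)"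
  using size_le_D_mult[OF Max_Min_length_set(2)[OF assms(1)]] assms(2) by (cases "Min (length_set A)") auto

lemma two_Max_le_D_Min:
  assumes "(A :: 'a multiset) \<in> zero_sum_seqs"
  shows "2 * Max (length_set A) \<le> D * Min (length_set A)"
proof -
  have "2 * Max (length_set A) \<le> size A + count A 0"
    "size A + (D - 1) * count A 0 \<le> D * Min (length_set A)"
    by (rule length_bounds_with_zeros[OF Max_Min_length_set(1)[OF assms]]
        length_bounds_with_zeros[OF Max_Min_length_set(2)[OF assms]])+
  moreover have "1 \<le> D - 1" using D_ge_3 by linarith
  from mult_le_mono1[OF this, of "count A 0"] have "count A 0 \<le> (D - 1) * count A 0"
    by (simp only: mult_1)
  ultimately show ?thesis by linarith
qed

lemma set_elasticity_eq_iff: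
  assumes A: "(A :: 'a multiset) \<in> zero_sum_seqs" "A \<noteq> {#}"
  shows "set_elasticity (length_set A) = real D / 2 \<longleftrightarrow>
    2 * Max (length_set A) = D * Min (length_set A)"
proof -
  have "set_elasticity (length_set A) = real D / 2 \<longleftrightarrow>
    real (2 * Max (length_set A)) = real (D * Min (length_set A))"
    unfolding set_elasticity_def using Min_length_set_pos[OF A] by (simp add: field_simps)
  then show ?thesis by (simp only: of_nat_eq_iff)
qed

text \<open>From left to right, equality throughout \<open>length_bounds_with_zeros\<close> excludes the term \<open>0\<close>
  since \<open>D > 2\<close>, so both extreme lengths attain the bounds \<open>|A| / 2\<close> and \<open>|A| / D\<close>.\<close>

lemma extreme_lengths_iff:
  assumes A: "(A :: 'a multiset) \<in> zero_sum_seqs"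
  shows "2 * Max (length_set A) = D * Min (length_set A) \<longleftrightarrow>
    (\<exists>k\<in>length_set A. 2 * k = size A) \<and> (\<exists>l\<in>length_set A. D * l = size A)"
proof
  note M = Max_Min_length_set[OF A]
  assume eq: "2 * Max (length_set A) = D * Min (length_set A)"
  have le: "2 * Max (length_set A) \<le> size A + count A 0"
    "size A + (D - 1) * count A 0 \<le> D * Min (length_set A)"
    by (rule length_bounds_with_zeros[OF M(1)] length_bounds_with_zeros[OF M(2)])+
  have "2 * count A 0 \<le> (D - 1) * count A 0" using D_ge_3 by (intro mult_le_mono1) simp
  then have "count A 0 = 0" using le eq by linarith
  then have "2 * Max (length_set A) = size A" "D * Min (length_set A) = size A" using le eq by auto
  then show "(\<exists>k\<in>length_set A. 2 * k = size A) \<and> (\<exists>l\<in>length_set A. D * l = size A)"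
    using M by blast
next
  note M = Max_Min_length_set[OF A]
  assume "(\<exists>k\<in>length_set A. 2 * k = size A) \<and> (\<exists>l\<in>length_set A. D * l = size A)"
  then obtain k l where kl: "k \<in> length_set A" "2 * k = size A" "l \<in> length_set A" "D * l = size A"
    by blast
  have "k \<le> Max (length_set A)" "Min (length_set A) \<le> l"
    using kl Max_ge[OF finite_length_set] Min_le[OF finite_length_set] by blast+
  then have "2 * k \<le> 2 * Max (length_set A)" "D * Min (length_set A) \<le> D * l" by simp_all
  then show "2 * Max (length_set A) = D * Min (length_set A)"
    using kl two_Max_le_D_Min[OF A] by linarith
qed

lemma symmetric_lengths:
  assumes U: "(U :: 'a multiset) \<in> min_zero_sum_seqs" "size U = D"
  shows "2 \<in> length_set (U + image_mset uminus U)" "D \<in> length_set (U + image_mset uminus U)"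
proof -
  have "1 + 1 \<in> length_set (U + image_mset uminus U)"
    by (intro length_set_add length_set_atom uminus_atom U)
  then show "2 \<in> length_set (U + image_mset uminus U)" by (simp only: one_add_one)
  show "D \<in> length_set (U + image_mset uminus U)"
    using length_set_symmetric[of U] no_zero_in_long_atom[OF U(1)] U(2) D_ge_3 by auto
qed

text \<open>The supremum is attained at \<open>U (-U)\<close> for an atom \<open>U\<close> of length \<open>D\<close>.\<close>

lemma elasticity_eq: "elasticity TYPE('a) = real D / 2"
  unfolding elasticity_def
proof (rule cSup_eq_maximum)
  obtain U :: "'a multiset" where U: "U \<in> min_zero_sum_seqs" "size U = D"
    using ex_longest_atom by blast
  define A where "A = U + image_mset uminus U"
  have L: "2 \<in> length_set A" "D \<in> length_set A" "size A = 2 * D"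
    unfolding A_def using symmetric_lengths[OF U] U(2) by auto
  have A: "A \<in> zero_sum_seqs" "A \<noteq> {#}"
    using length_set_zero_sum[OF L(1)] min_zero_sum_seqsD(2)[OF U(1)]
    unfolding zero_sum_seqs_def by (auto simp: A_def)
  have "2 * D = size A" "D * 2 = size A" using L(3) by simp_all
  then have "set_elasticity (length_set A) = real D / 2"
    unfolding set_elasticity_eq_iff[OF A] extreme_lengths_iff[OF A(1)] using L by blast
  then show "real D / 2 \<in> (\<lambda>A. set_elasticity (length_set A)) ` (zero_sum_seqs - {{#} :: 'a multiset})"
    using A by (intro image_eqI[of _ _ A]) auto
next
  fix x assume "x \<in> (\<lambda>A. set_elasticity (length_set A)) ` (zero_sum_seqs - {{#} :: 'a multiset})"
  then obtain A :: "'a multiset" where A: "A \<in> zero_sum_seqs" "A \<noteq> {#}"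
    and x: "x = set_elasticity (length_set A)" by auto
  have "real (2 * Max (length_set A)) \<le> real (D * Min (length_set A))"
    using two_Max_le_D_Min[OF A(1)] by (simp only: of_nat_le_iff)
  then show "x \<le> real D / 2"
    unfolding x set_elasticity_def using Min_length_set_pos[OF A] by (simp add: field_simps)
qed

text \<open>Since atoms have at most \<open>D\<close> terms and, apart from \<open>0\<close>, at least two, the right-hand side says
  that \<open>B\<close> is both a product of atoms of length \<open>2\<close> and a product of atoms of length \<open>D\<close>.\<close>

lemma max_elastic_iff:
  "(B :: 'a multiset) \<in> max_elastic_seqs \<longleftrightarrow>
    (\<exists>k\<in>length_set B. 2 * k = size B) \<and> (\<exists>l\<in>length_set B. D * l = size B)"
proof (cases "B = {#}")
  case True
  then show ?thesis unfolding max_elastic_seqs_def using length_set_empty by auto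
next
  case False
  show ?thesis
  proof (cases "B \<in> zero_sum_seqs")
    case True
    then show ?thesis unfolding max_elastic_seqs_def
      using False set_elasticity_eq_iff[OF True False] extreme_lengths_iff[OF True]
      by (simp add: elasticity_eq)
  next
    case not_zero_sum: False
    then have "length_set B = {}"
      using length_set_zero_sum unfolding zero_sum_seqs_def by blast
    then show ?thesis using False not_zero_sum unfolding max_elastic_seqs_def by simp
  qed
qed

section \<open>Finite generation of the sequences of maximal elasticity\<close>

text \<open>A pair of a factorization into atoms of length \<open>D\<close> and a factorization into atoms of length
  \<open>2\<close> is encoded as one multiset of atoms, from which the two parts are recovered by length because
  \<open>D \<noteq> 2\<close>. The multisets whose two parts have equal products are closed under differences, and
  taking the product of a part is additive.\<close>

lemma max_elastic_finitely_generated: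
  obtains P where "finitely_generated (max_elastic_seqs :: 'a multiset set) P"
proof -
  define I where "I = {U :: 'a multiset. U \<in> min_zero_sum_seqs \<and> (size U = D \<or> size U = 2)}"
  define \<phi> where "\<phi> c K = sum_mset (filter_mset (\<lambda>U. size U = c) K)"
    for c and K :: "'a multiset multiset"
  define X where "X = {K. set_mset K \<subseteq> I \<and> \<phi> D K = \<phi> 2 K}"
  have \<phi>_add: "\<phi> c (K + L) = \<phi> c K + \<phi> c L" for c K L unfolding \<phi>_def by simp
  have "finite I" unfolding I_def by (rule finite_subset[OF _ finite_min_zero_sum_seqs]) auto
  moreover have "K \<in> X \<Longrightarrow> set_mset K \<subseteq> I" for K unfolding X_def by blast
  moreover have "L \<in> X" if "K \<in> X" "K + L \<in> X" for K L
    using that unfolding X_def by (simp add: \<phi>_add)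
  ultimately obtain P where P: "finite P" "P \<subseteq> X"
    "\<forall>K\<in>X. \<exists>Q. set_mset Q \<subseteq> P \<and> sum_mset Q = K"
    by (rule finitely_generated_if_difference_closed[of I X])
  have mem: "\<phi> D K \<in> max_elastic_seqs" if K: "K \<in> X" for K
  proof -
    have len: "size (filter_mset (\<lambda>U. size U = c) K) \<in> length_set (\<phi> c K)"
      "c * size (filter_mset (\<lambda>U. size U = c) K) = size (\<phi> c K)" for c
    proof -
      show "size (filter_mset (\<lambda>U. size U = c) K) \<in> length_set (\<phi> c K)"
        using K unfolding X_def I_def \<phi>_def by (intro length_setI) auto
      show "c * size (filter_mset (\<lambda>U. size U = c) K) = size (\<phi> c K)"
        unfolding \<phi>_def by (intro antisym size_sum_mset_le size_sum_mset_ge) auto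
    qed
    have "\<phi> D K = \<phi> 2 K" using K unfolding X_def by blast
    then show ?thesis using len[of D] len[of 2] unfolding max_elastic_iff by metis
  qed
  have ex: "\<exists>K\<in>X. \<phi> D K = B" if B: "B \<in> max_elastic_seqs" for B :: "'a multiset"
  proof -
    obtain k l where k: "k \<in> length_set B" "2 * k = size B" and l: "l \<in> length_set B" "D * l = size B"
      using B unfolding max_elastic_iff by blast
    obtain F where F: "set_mset F \<subseteq> min_zero_sum_seqs" "sum_mset F = B" "size F = l"
      using l(1) by (rule length_setE)
    obtain H where H: "set_mset H \<subseteq> min_zero_sum_seqs" "sum_mset H = B" "size H = k"
      using k(1) by (rule length_setE)
    have sF: "size U = D" if "U \<in># F" for U
    proof (rule sizes_eq_if_sum_max[OF _ _ that])
      show "size U \<le> D" if "U \<in># F" for U using that F(1) atom_size_le by blast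
      show "size (sum_mset F) = D * size F" using F l by simp
    qed
    have sH: "size U = 2" if "U \<in># H" for U
    proof (rule sizes_eq_if_sum_min[OF _ _ that])
      show "2 \<le> size U" if "U \<in># H" for U
      proof (rule no_zero_two_le_size)
        have "U \<in> min_zero_sum_seqs" using that H(1) by blast
        then show "U \<noteq> {#}" "sum_mset U = 0" by (auto dest: min_zero_sum_seqsD)
        show "0 \<notin># U" using no_zero_if_D_mult[OF l] H(2) that by (auto simp: in_Union_mset_iff)
      qed
      show "size (sum_mset H) = 2 * size H" using H k by simp
    qed
    have D2: "D \<noteq> 2" using D_ge_3 by simp
    have split: "filter_mset (\<lambda>U. size U = D) F = F" "filter_mset (\<lambda>U. size U = D) H = {#}"
      "filter_mset (\<lambda>U. size U = 2) F = {#}" "filter_mset (\<lambda>U. size U = 2) H = H"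
      using sF sH D2 by (auto simp: filter_mset_eq_conv)
    have "\<phi> D (F + H) = B" "\<phi> 2 (F + H) = B" unfolding \<phi>_def by (simp_all add: split F(2) H(2))
    moreover have "set_mset (F + H) \<subseteq> I" using F(1) H(1) sF sH unfolding I_def by auto
    ultimately have "F + H \<in> X" unfolding X_def by simp
    then show ?thesis using \<open>\<phi> D (F + H) = B\<close> by blast
  qed
  have "finitely_generated (max_elastic_seqs :: 'a multiset set) (\<phi> D ` P - {{#}})"
  proof
    show "{#} \<in> (max_elastic_seqs :: 'a multiset set)" unfolding max_elastic_seqs_def by simp
    show "A + B \<in> max_elastic_seqs" if "A \<in> max_elastic_seqs" "B \<in> max_elastic_seqs"
      for A B :: "'a multiset"
    proof -
      obtain k l k' l' where "k \<in> length_set A" "2 * k = size A" "l \<in> length_set A" "D * l = size A"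
        "k' \<in> length_set B" "2 * k' = size B" "l' \<in> length_set B" "D * l' = size B"
        using \<open>A \<in> _\<close> \<open>B \<in> _\<close> unfolding max_elastic_iff by blast
      then show ?thesis unfolding max_elastic_iff
        by (intro conjI bexI[of _ "k + k'"] bexI[of _ "l + l'"] length_set_add)
          (auto simp: distrib_left)
    qed
    show "finite (\<phi> D ` P - {{#}})" using P(1) by simp
    show "\<phi> D ` P - {{#}} \<subseteq> max_elastic_seqs" using P(2) mem by auto
    show "{#} \<notin> \<phi> D ` P - {{#}}" by simp
    show "\<exists>Q. set_mset Q \<subseteq> \<phi> D ` P - {{#}} \<and> sum_mset Q = B" if B: "B \<in> max_elastic_seqs" for B
    proof -
      obtain K where K: "K \<in> X" "\<phi> D K = B" using ex[OF B] by blast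
      obtain Q where "set_mset Q \<subseteq> P \<and> sum_mset Q = K" using bspec[OF P(3) K(1)] ..
      then have Q: "set_mset Q \<subseteq> P" "\<phi> D (sum_mset Q) = B" using K(2) by simp_all
      have "\<phi> D (sum_mset Q) = sum_mset (image_mset (\<phi> D) Q)"
        by (induction Q) (auto simp: \<phi>_add, simp add: \<phi>_def)
      moreover have "sum_mset (filter_mset (\<lambda>A. A \<noteq> {#}) R) = sum_mset R" for R :: "'a multiset multiset"
        by (induction R) auto
      ultimately show ?thesis using Q
        by (intro exI[of _ "filter_mset (\<lambda>A. A \<noteq> {#}) (image_mset (\<phi> D) Q)"]) auto
    qed
  qed
  then show thesis by (rule that)
qed

section \<open>A sequence that turns length sets into intervals\<close>

lemma length_set_interval_if_extremes:
  assumes "{a..b} \<subseteq> length_set (A :: 'a multiset)" "a \<le> b" "D * a = size A" "2 * b = size A"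
  shows "is_nat_interval (length_set A)"
proof -
  have "a \<in> length_set A" using assms(1,2) by auto
  then have nz: "0 \<notin># A" using no_zero_if_D_mult assms(3) by blast
  have "k \<in> {a..b}" if "k \<in> length_set A" for k
  proof -
    have "D * a \<le> D * k" using size_le_D_mult[OF that] assms(3) by simp
    moreover have "2 * k \<le> 2 * b" using size_ge_2_mult[OF that nz] assms(4) by simp
    ultimately show ?thesis using D_ge_3 by simp
  qed
  then have "length_set A = {a..b}" using assms(1) by blast
  then show ?thesis unfolding is_nat_interval_def using assms(2) by blast
qed

text \<open>The invariant of the induction is that the length set contains the full range from
  \<open>|B| / D\<close> to \<open>|B| / 2\<close> and that this range does not become shorter. A member \<open>p\<close> of \<open>Q\<close> has
  extreme lengths \<open>|p| / D\<close> and \<open>|p| / 2\<close>, which differ by at most \<open>|p|\<close>.\<close>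

lemma interval_stable_under_generators:
  assumes Q: "set_mset Q \<subseteq> (max_elastic_seqs :: 'a multiset set)" "\<And>p. p \<in># Q \<Longrightarrow> size p \<le> b - a"
    and A: "{a..b} \<subseteq> length_set (A :: 'a multiset)" "a \<le> b" "D * a = size A" "2 * b = size A"
  shows "is_nat_interval (length_set (A + sum_mset Q))"
proof -
  have "\<exists>a' b'. {a'..b'} \<subseteq> length_set (A + sum_mset Q) \<and> a' \<le> b' \<and> b - a \<le> b' - a' \<and>
    D * a' = size (A + sum_mset Q) \<and> 2 * b' = size (A + sum_mset Q)"
    using Q
  proof (induction Q)
    case empty
    then show ?case using A by auto
  next
    case (add p Q)
    then obtain a' b' where IH: "{a'..b'} \<subseteq> length_set (A + sum_mset Q)" "a' \<le> b'"
      "b - a \<le> b' - a'" "D * a' = size (A + sum_mset Q)" "2 * b' = size (A + sum_mset Q)"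
      by auto
    have "p \<in> max_elastic_seqs" using add.prems(1) by simp
    then obtain h l where p: "h \<in> length_set p" "2 * h = size p" "l \<in> length_set p" "D * l = size p"
      unfolding max_elastic_iff by blast
    have "2 * l \<le> D * l" using D_ge_3 by (intro mult_le_mono1) simp
    then have "l \<le> h" using p by simp
    moreover have "size p \<le> b - a" using add.prems(2) by simp
    ultimately have "{a' + l..b' + h} \<subseteq> length_set (A + sum_mset Q + p)"
      using IH p by (intro length_set_interval_absorb) auto
    moreover have "A + sum_mset Q + p = A + sum_mset (add_mset p Q)" by simp
    ultimately show ?case using IH p \<open>l \<le> h\<close>
      by (intro exI[of _ "a' + l"] exI[of _ "b' + h"]) (auto simp: distrib_left)
  qed
  then show ?thesis using length_set_interval_if_extremes by blast
qed

text \<open>Write \<open>U\<^sub>1 = g\<^sub>1 g\<^sub>2 T\<close> and \<open>U\<^sub>2 = (g\<^sub>1 + g\<^sub>2) R\<close>. The extreme lengths \<open>4\<close> and \<open>2 D\<close> are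
  those of the factorization that defines \<open>W\<close> and of the one into pairs \<open>g (-g)\<close>.

  Swapping \<open>g\<^sub>1 g\<^sub>2\<close> with \<open>g\<^sub>1 + g\<^sub>2\<close> turns \<open>U\<^sub>1 U\<^sub>2\<close> into the product of the atom
  \<open>(g\<^sub>1 + g\<^sub>2) T\<close> and of \<open>g\<^sub>1 g\<^sub>2 R\<close>. The latter has \<open>D + 1\<close> terms and is no atom; it has exactly
  two factors, since \<open>R\<close> is zero-sum free. This gives the length \<open>5\<close>.

  At the other end, the pairs of \<open>g\<^sub>1\<close>, \<open>g\<^sub>2\<close> and \<open>g\<^sub>1 + g\<^sub>2\<close> with their inverses can be regrouped
  into the atom \<open>g\<^sub>1 g\<^sub>2 (-(g\<^sub>1 + g\<^sub>2))\<close> and its negative. Two atoms replace three, which gives the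
  length \<open>2 D - 1\<close>.\<close>

lemma exchange_lengths:
  fixes U1 U2 :: "'a multiset" and g1 g2 :: 'a
  assumes U1: "U1 \<in> min_zero_sum_seqs" "size U1 = D" and U2: "U2 \<in> min_zero_sum_seqs" "size U2 = D"
    and g: "{#g1, g2#} \<subseteq># U1" "{#g1 + g2#} \<subseteq># U2"
  defines "W \<equiv> U1 + image_mset uminus U1 + (U2 + image_mset uminus U2)"
  shows "4 \<in> length_set W" "5 \<in> length_set W" "2 * D - 1 \<in> length_set W" "2 * D \<in> length_set W"
proof -
  obtain T where T: "U1 = {#g1, g2#} + T" using g(1) by (metis subset_mset.le_iff_add)
  obtain R where R: "U2 = {#g1 + g2#} + R" using g(2) by (metis subset_mset.le_iff_add)
  have nz1: "0 \<notin># U1" and nz2: "0 \<notin># U2"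
    using no_zero_in_long_atom[OF U1(1)] no_zero_in_long_atom[OF U2(1)] U1(2) U2(2) D_ge_3 by auto
  have sums: "g1 + g2 + sum_mset T = 0" "g1 + g2 + sum_mset R = 0"
    using min_zero_sum_seqsD(1)[OF U1(1)] min_zero_sum_seqsD(1)[OF U2(1)]
    unfolding T R by (simp_all add: add.assoc)
  have neg: "1 \<in> length_set (image_mset uminus U1)" "1 \<in> length_set (image_mset uminus U2)"
    using length_set_atom uminus_atom U1 U2 by blast+
  note sym1 = symmetric_lengths[OF U1]
  note sym2 = symmetric_lengths[OF U2]
  show "4 \<in> length_set W" "2 * D \<in> length_set W"
    using length_set_add[OF sym1(1) sym2(1)] length_set_add[OF sym1(2) sym2(2)]
    unfolding W_def by (simp_all add: mult_2)
  \<comment> \<open>A splitting of \<open>(g\<^sub>1 + g\<^sub>2) T\<close> becomes one of \<open>U\<^sub>1\<close> when \<open>g\<^sub>1 + g\<^sub>2\<close> is replaced by \<open>g\<^sub>1 g\<^sub>2\<close>.\<close>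
  have "{#g1 + g2#} + T \<in> min_zero_sum_seqs"
  proof (rule min_zero_sum_seqsI)
    have no_split: "T' = {#}"
      if "T = S + T'" "g1 + g2 + sum_mset S = 0" for S T'
      using min_zero_sum_seqsD(3)[OF U1(1), of "{#g1, g2#} + S" T'] that T by (simp add: add.assoc)
    fix S S' assume S: "{#g1 + g2#} + T = S + S'" "sum_mset S = 0" "sum_mset S' = 0" "S \<noteq> {#}"
    have "g1 + g2 \<in># S + S'" unfolding S(1)[symmetric] by simp
    then consider "g1 + g2 \<in># S" | "g1 + g2 \<in># S'" by auto
    then show "S' = {#}"
    proof cases
      case 1
      then obtain S0 where "S = add_mset (g1 + g2) S0" by (metis mset_add)
      then show ?thesis using no_split[of S0 S'] S by simp
    next
      case 2
      then obtain S0 where "S' = add_mset (g1 + g2) S0" by (metis mset_add)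
      then show ?thesis using no_split[of S0 S] S by (simp add: add.commute)
    qed
  qed (use sums in auto)
  moreover have "2 \<in> length_set ({#g1, g2#} + R)"
  proof -
    have "{#g1, g2#} + R \<in> zero_sum_seqs"
      using sums unfolding zero_sum_seqs_def by (simp add: add.assoc)
    then obtain k where k: "k \<in> length_set ({#g1, g2#} + R)" using length_set_nonempty by blast
    then obtain F where F: "set_mset F \<subseteq> min_zero_sum_seqs" "sum_mset F = {#g1, g2#} + R" "size F = k"
      by (rule length_setE)
    have "size ({#g1, g2#} + R) = Suc D" using U2(2) R by simp
    then have "Suc D \<le> D * k" using size_le_D_mult[OF k] by simp
    then have "\<not> D * k \<le> D * 1" by linarith
    then have "\<not> k \<le> 1" using mult_le_mono2 by blast
    moreover have "k \<le> 2"
    proof (rule ccontr)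
      assume "\<not> k \<le> 2"
      then have "\<exists>S\<in>#F. S \<subseteq># R" using F by (intro avoiding_member[of F "{#g1, g2#}"]) auto
      then obtain S R' where S: "S \<in># F" "R = S + R'" by (auto simp: subset_mset.le_iff_add)
      then have "S \<in> min_zero_sum_seqs" using F(1) by blast
      then have "sum_mset S = 0" "S \<noteq> {#}" by (auto dest: min_zero_sum_seqsD)
      then show False
        using min_zero_sum_seqsD(3)[OF U2(1), of S "add_mset (g1 + g2) R'"] R S(2) by simp
    qed
    ultimately have "k = 2" by linarith
    then show ?thesis using k by simp
  qed
  ultimately have "1 + 2 + (1 + 1) \<in> length_set ({#g1 + g2#} + T + ({#g1, g2#} + R) +
      (image_mset uminus U1 + image_mset uminus U2))"
    by (intro length_set_add length_set_atom neg)
  moreover have "{#g1 + g2#} + T + ({#g1, g2#} + R) + (image_mset uminus U1 + image_mset uminus U2) = W"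
    unfolding W_def by (simp add: T R ac_simps)
  moreover have "1 + 2 + (1 + 1) = (5 :: nat)" by simp
  ultimately show "5 \<in> length_set W" by metis
  have nz: "g1 \<noteq> 0" "g2 \<noteq> 0" "g1 + g2 \<noteq> 0" "0 \<notin># T" "0 \<notin># R"
    using nz1 nz2 unfolding T R by auto
  define V where "V = {#g1, g2, - (g1 + g2)#}"
  have V: "V \<in> min_zero_sum_seqs" unfolding V_def by (rule three_term_atom) (use nz in auto)
  have "1 + 1 + (size T + size R) \<in> length_set (V + image_mset uminus V +
      ((T + image_mset uminus T) + (R + image_mset uminus R)))"
    by (intro length_set_add length_set_atom V uminus_atom length_set_symmetric nz)
  moreover have "V + image_mset uminus V + ((T + image_mset uminus T) + (R + image_mset uminus R)) = W"
    unfolding W_def V_def by (simp add: T R ac_simps)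
  moreover have "1 + 1 + (size T + size R) = 2 * D - 1" using U1(2) U2(2) T R D_ge_3 by simp
  ultimately show "2 * D - 1 \<in> length_set W" by metis
qed

lemma ex_interval_absorber:
  fixes g1 g2 :: 'a
  assumes fg: "finitely_generated (max_elastic_seqs :: 'a multiset set) P"
    and U1: "U1 \<in> min_zero_sum_seqs" "size U1 = D" and U2: "U2 \<in> min_zero_sum_seqs" "size U2 = D"
    and g: "{#g1, g2#} \<subseteq># U1" "{#g1 + g2#} \<subseteq># U2"
  obtains A :: "'a multiset" where "A \<in> max_elastic_seqs"
    "\<forall>C\<in>max_elastic_seqs. is_nat_interval (length_set (A + C))"
proof -
  interpret finitely_generated "max_elastic_seqs :: 'a multiset set" P by (rule fg)
  define W where "W = U1 + image_mset uminus U1 + (U2 + image_mset uminus U2)"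
  note L = exchange_lengths[OF U1 U2 g, folded W_def]
  have sW: "size W = 4 * D" unfolding W_def using U1 U2 by simp
  have W: "W \<in> max_elastic_seqs"
    unfolding max_elastic_iff using L(1,4) sW
    by (auto intro!: bexI[of _ "2 * D"] bexI[of _ 4])
  define K where "K = (\<Sum>p\<in>P. size p)"
  \<comment> \<open>The summand \<open>2 D\<close> makes the lengths of \<open>k W\<close> an interval; the summand \<open>K\<close> makes it longer than
    every generator.\<close>
  define k where "k = 2 * D + K"
  define A where "A = repeat_mset k W"
  have sub: "{k * 4..k * Suc (2 * D - 1)} \<subseteq> length_set A"
    unfolding A_def using L D_ge_3 by (intro length_set_repeat_full) (auto simp: k_def)
  have "4 * k + 2 * k \<le> 2 * D * k" using D_ge_3 mult_le_mono1[of 6 "2 * D" k] by simp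
  then have kD: "K \<le> k * Suc (2 * D - 1) - k * 4" "k * 4 \<le> k * Suc (2 * D - 1)"
    using D_ge_3 by (auto simp: k_def algebra_simps)
  have "is_nat_interval (length_set (A + C))" if C: "C \<in> max_elastic_seqs" for C
  proof -
    obtain Q where Q: "set_mset Q \<subseteq> P" "sum_mset Q = C" using generates[OF C] by blast
    have "size p \<le> K" if "p \<in> P" for p
      unfolding K_def using that finite_gens by (simp add: member_le_sum)
    then have "is_nat_interval (length_set (A + sum_mset Q))"
      using Q(1) gens_mem kD(1) D_ge_3 sW
      by (intro interval_stable_under_generators[OF _ _ sub kD(2)])
        (auto simp: A_def intro: order.trans)
    then show ?thesis using Q(2) by simp
  qed
  moreover have "A \<in> max_elastic_seqs" unfolding A_def by (rule repeat_mem[OF W])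
  ultimately show thesis using that by blast
qed

end

theorem corollary3p9:
  assumes "CARD('a::{finite, ab_group_add}) \<ge> 3"
  shows
    "(\<forall>\<alpha>::nat.
        (\<lambda>n. real (card {B \<in> max_elastic_seqs :: 'a multiset set. int (size B) \<le> int n - int \<alpha>}) /
             real (card {B \<in> max_elastic_seqs :: 'a multiset set. size B \<le> n}))
        \<longlonglongrightarrow> 1)
     \<and>
     ((\<exists>(g1::'a) g2 U1 U2. U1 \<in> min_zero_sum_seqs \<and> U2 \<in> min_zero_sum_seqs \<and>
          size U1 = davenport TYPE('a) \<and> size U2 = davenport TYPE('a) \<and>
          {#g1, g2#} \<subseteq># U1 \<and> {#g1 + g2#} \<subseteq># U2)
      \<longrightarrow>
      (\<lambda>n. real (card {B \<in> max_elastic_seqs :: 'a multiset set.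
                    size B \<le> n \<and> is_nat_interval (length_set B)}) /
           real (card {B \<in> max_elastic_seqs :: 'a multiset set. size B \<le> n}))
      \<longlonglongrightarrow> 1)"
proof -
  obtain P where fg: "finitely_generated (max_elastic_seqs :: 'a multiset set) P"
    using max_elastic_finitely_generated[OF assms refl] by blast
  interpret finitely_generated "max_elastic_seqs :: 'a multiset set" P by (rule fg)
  show ?thesis
  proof (intro conjI allI impI)
    fix \<alpha> :: nat
    show "(\<lambda>n. real (card {B \<in> max_elastic_seqs :: 'a multiset set. int (size B) \<le> int n - int \<alpha>}) /
        real (card {B \<in> max_elastic_seqs :: 'a multiset set. size B \<le> n})) \<longlonglongrightarrow> 1"
      by (rule ball_ratio_tendsto_1)
  next
    assume "\<exists>(g1::'a) g2 U1 U2. U1 \<in> min_zero_sum_seqs \<and> U2 \<in> min_zero_sum_seqs \<and>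
          size U1 = davenport TYPE('a) \<and> size U2 = davenport TYPE('a) \<and>
          {#g1, g2#} \<subseteq># U1 \<and> {#g1 + g2#} \<subseteq># U2"
    then obtain g1 g2 :: 'a and U1 U2 where "U1 \<in> min_zero_sum_seqs" "size U1 = davenport TYPE('a)"
      "U2 \<in> min_zero_sum_seqs" "size U2 = davenport TYPE('a)"
      "{#g1, g2#} \<subseteq># U1" "{#g1 + g2#} \<subseteq># U2" by blast
    from ex_interval_absorber[OF assms refl fg this] obtain A :: "'a multiset"
      where A: "A \<in> max_elastic_seqs"
        "\<forall>C\<in>max_elastic_seqs. is_nat_interval (length_set (A + C))" .
    show "(\<lambda>n. real (card {B \<in> max_elastic_seqs :: 'a multiset set.
          size B \<le> n \<and> is_nat_interval (length_set B)}) /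
        real (card {B \<in> max_elastic_seqs :: 'a multiset set. size B \<le> n})) \<longlonglongrightarrow> 1"
      using A(2) by (intro absorbing_ratio_tendsto_1[OF A(1)]) blast
  qed
qed

end
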